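(* Let $\mathcal H$ be a complex Hilbert space, $T\in\mathcal B(\mathcal H)$, $T\ne0$, with polar decomposition $T=U|T|$. Let $\{x_n\}\subset\mathcal H$ with $\|x_n\|=1$ and $w(T)=\lim_{n\to\infty}|\langle Tx_n,x_n\rangle|$. Then for all $t\in[0,1]$, $$w(T)\le\|T\|-\|T\|^{1-t}\lim_{n\to\infty}\frac{\||T^*|^{t/2}x_n\|}{4\||T|^{t/2}x_n\|}\inf_{\lambda\in\mathbb C}\big\|(|T|^{t/2}-\lambda|T|^{t/2}U^* )x_n\big\|^2\le\|T\|$$ (the limit being assumed to exist).
   Context: $|T|=(T^*T)^{1/2}$, $|T^*|=(TT^* )^{1/2}$, powers via functional calculus with $|T|^0=I$; $T=U|T|$ is the polar decomposition with $U$ a partial isometry; $\|\cdot\|$ is the operator norm; $w(T)=\sup_{\|x\|=1}|\langle Tx,x\rangle|$ is the numerical radius. *)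

theory Defs
  imports "HOL-Analysis.Analysis" "HOL-Computational_Algebra.Polynomial"
begin

text \<open>A complex Hilbert space, presented as a real Hilbert space together with a
  complex structure (multiplication by the imaginary unit) that is real-linear,
  squares to minus the identity and is orthogonal.  Complex scalar multiplication
  and the complex inner product (linear in the first argument) are derived from it.\<close>

class complex_hilbert = real_inner + complete_space +
  fixes imult :: "'a \<Rightarrow> 'a"
  assumes imult_add: "imult (x + y) = imult x + imult y"
    and imult_scaleR: "imult (scaleR r x) = scaleR r (imult x)"
    and imult_imult: "imult (imult x) = - x"
    and inner_imult: "inner (imult x) (imult y) = inner x y"

definition scaleC :: "complex \<Rightarrow> 'a::complex_hilbert \<Rightarrow> 'a" where
  "scaleC c x = Re c *\<^sub>R x + Im c *\<^sub>R imult x"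

definition cinner :: "'a::complex_hilbert \<Rightarrow> 'a \<Rightarrow> complex" where
  "cinner x y = Complex (inner x y) (inner x (imult y))"

definition is_bop :: "('a::complex_hilbert \<Rightarrow> 'a) \<Rightarrow> bool" where
  "is_bop T \<longleftrightarrow> bounded_linear T \<and> (\<forall>x. T (imult x) = imult (T x))"

definition adj :: "('a::complex_hilbert \<Rightarrow> 'a) \<Rightarrow> ('a \<Rightarrow> 'a)" where
  "adj T = (THE S. is_bop S \<and> (\<forall>x y. cinner (T x) y = cinner x (S y)))"

definition poly_op :: "real poly \<Rightarrow> ('a::complex_hilbert \<Rightarrow> 'a) \<Rightarrow> 'a \<Rightarrow> 'a" where
  "poly_op p A v = (\<Sum>i\<le>degree p. coeff p i *\<^sub>R (A ^^ i) v)"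

text \<open>Continuous functional calculus for the power function \<open>x \<mapsto> x^s\<close>, \<open>s \<ge> 0\<close>,
  of a positive operator \<open>A\<close>: \<open>A^s\<close> is the operator-norm limit of \<open>p_n(A)\<close> for any
  sequence of polynomials \<open>p_n\<close> converging uniformly to \<open>x^s\<close> on \<open>[0,\<parallel>A\<parallel>]\<close>
  (which contains the spectrum of \<open>A\<close>).  Convention \<open>A^0 = I\<close>.\<close>
definition op_pow :: "('a::complex_hilbert \<Rightarrow> 'a) \<Rightarrow> real \<Rightarrow> ('a \<Rightarrow> 'a)" where
  "op_pow A s = (if s = 0 then id else
     (THE B. bounded_linear B \<and>
        (\<exists>p :: nat \<Rightarrow> real poly.
           (\<forall>e>0. \<exists>N. \<forall>n\<ge>N. \<forall>y\<in>{0..onorm A}. \<bar>poly (p n) y - y powr s\<bar> < e) \<and>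
           ((\<lambda>n. onorm (\<lambda>v. poly_op (p n) A v - B v)) \<longlonglongrightarrow> 0))))"

definition abs_op :: "('a::complex_hilbert \<Rightarrow> 'a) \<Rightarrow> ('a \<Rightarrow> 'a)" where
  "abs_op T = op_pow (adj T \<circ> T) (1/2)"

definition abs_adj :: "('a::complex_hilbert \<Rightarrow> 'a) \<Rightarrow> ('a \<Rightarrow> 'a)" where
  "abs_adj T = op_pow (T \<circ> adj T) (1/2)"

definition partial_isometry :: "('a::complex_hilbert \<Rightarrow> 'a) \<Rightarrow> bool" where
  "partial_isometry U \<longleftrightarrow> is_bop U \<and>
     (\<forall>x. (\<forall>y. U y = 0 \<longrightarrow> cinner x y = 0) \<longrightarrow> norm (U x) = norm x)"

definition numrad :: "('a::complex_hilbert \<Rightarrow> 'a) \<Rightarrow> real" where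
  "numrad T = (SUP x\<in>{x. norm x = 1}. cmod (cinner (T x) x))"

end

theory Submission
  imports Defs "HOL-Computational_Algebra.Fundamental_Theorem_Algebra"
begin

text \<open>
  Put \<open>A = |T|\<close>, \<open>M = norm T = norm A\<close>, \<open>a = A\<^bsup>t/2\<^esup> x\<close> and \<open>b = A\<^bsup>t/2\<^esup> U\<^sup>* x\<close>, so that
  \<open>\<langle>T x, x\<rangle> = \<langle>A\<^bsup>1-t\<^esup> a, b\<rangle>\<close>. Since \<open>0 \<le> A\<^bsup>1-t\<^esup> \<le> M\<^bsup>1-t\<^esup>\<close>, the operator \<open>2 A\<^bsup>1-t\<^esup> - M\<^bsup>1-t\<^esup>\<close> has norm at
  most \<open>M\<^bsup>1-t\<^esup>\<close>, whence \<open>|\<langle>T x, x\<rangle>| \<le> M\<^bsup>1-t\<^esup> (|a| |b| + |\<langle>a, b\<rangle>|) / 2\<close>. The infimum \<open>d\<^sup>2\<close> over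
  \<open>\<lambda>\<close> is \<open>|a|\<^sup>2 - |\<langle>a, b\<rangle>|\<^sup>2 / |b|\<^sup>2\<close>, so \<open>|\<langle>a, b\<rangle>| \<le> |b| (|a| - d\<^sup>2 / (2 |a|))\<close>. Finally
  \<open>|T\<^sup>*|\<^bsup>t/2\<^esup> = U A\<^bsup>t/2\<^esup> U\<^sup>*\<close> for \<open>t > 0\<close> gives \<open>|b| = norm (|T\<^sup>*|\<^bsup>t/2\<^esup> x)\<close>, and for \<open>t = 0\<close> the
  inequality \<open>|b| \<le> |x|\<close> suffices.
\<close>

subclass (in complex_hilbert) banach ..

section \<open>Orthogonal projections and adjoints\<close>

text \<open>Minimise \<open>|v|\<^sup>2 - 2 f v\<close> over the subspace; minimising sequences are Cauchy by the
  parallelogram law. The whole space gives Riesz representation, and \<open>f = inner y\<close> gives the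
  orthogonal projection of \<open>y\<close>.\<close>
lemma riesz_on_closed_subspace:
  fixes f :: "'a::{real_inner,complete_space} \<Rightarrow> real"
  assumes f: "bounded_linear f" and S: "subspace S" "closed S"
  obtains z where "z \<in> S" "\<And>h. h \<in> S \<Longrightarrow> f h = inner z h"
proof -
  interpret f: bounded_linear f by fact
  define J where "J v = (norm v)^2 - 2 * f v" for v
  obtain K where K: "\<And>v. norm (f v) \<le> norm v * K" using f.bounded by blast
  \<comment> \<open>Completing the square: \<open>J v\<close> is at least
    \<open>(norm v - K)^2 - K^2\<close>.\<close>
  have lower: "J v \<ge> - (K^2)" for v
  proof -
    have "f v \<le> norm v * K" using K[of v] by simp
    moreover have "0 \<le> (norm v - K)^2" by simp
    ultimately show ?thesis unfolding J_def by (simp add: power2_eq_square algebra_simps)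
  qed
  define m where "m = Inf (J ` S)"
  have bdd: "bdd_below (J ` S)" using lower by (intro bdd_belowI2)
  have ne: "J ` S \<noteq> {}" using subspace_0[OF S(1)] by auto
  have m_le: "m \<le> J v" if "v \<in> S" for v
    unfolding m_def using bdd that by (intro cInf_lower) auto
  have "\<exists>v\<in>S. J v < m + 1 / real (Suc n)" for n
    using cInf_lessD[OF ne, of "m + 1 / real (Suc n)"] unfolding m_def by auto
  then obtain v where v: "\<And>n. v n \<in> S" "\<And>n. J (v n) < m + 1 / real (Suc n)" by metis
  have par: "(norm (a - b))^2 = 2 * J a + 2 * J b - 4 * J ((1/2) *\<^sub>R (a + b))" for a b
  proof -
    have "J ((1/2) *\<^sub>R (a + b)) = (norm (a + b))^2 / 4 - f a - f b"
      unfolding J_def by (simp add: f.scaleR f.add power_divide del: scaleR_add_right) (simp add: field_simps)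
    moreover have "(norm (a - b))^2 = 2 * (norm a)^2 + 2 * (norm b)^2 - (norm (a + b))^2"
      by (simp add: power2_norm_eq_inner inner_simps inner_commute)
    ultimately show ?thesis unfolding J_def[of a] J_def[of b] by simp
  qed
  have dist: "(norm (v i - v j))^2 \<le> 2 / real (Suc i) + 2 / real (Suc j)" for i j
  proof -
    have "(1/2) *\<^sub>R (v i + v j) \<in> S" using v S by (intro subspace_mul subspace_add) auto
    from m_le[OF this] v(2)[of i] v(2)[of j] par[of "v i" "v j"] show ?thesis by simp
  qed
  have "Cauchy v"
  proof (rule metric_CauchyI)
    fix e :: real assume e: "e > 0"
    obtain N where N: "1 / real (Suc N) < e^2 / 4"
      using reals_Archimedean[of "e^2/4"] e by (auto simp: inverse_eq_divide)
    show "\<exists>M. \<forall>i\<ge>M. \<forall>j\<ge>M. dist (v i) (v j) < e"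
    proof (intro exI allI impI)
      fix i j assume ij: "i \<ge> N" "j \<ge> N"
      have "1 / real (Suc i) \<le> 1 / real (Suc N)" "1 / real (Suc j) \<le> 1 / real (Suc N)"
        using ij by (auto simp: frac_le)
      with dist[of i j] N have "(norm (v i - v j))^2 < e^2" by simp
      then show "dist (v i) (v j) < e" unfolding dist_norm using e power_less_imp_less_base by fastforce
    qed
  qed
  then obtain z where z: "v \<longlonglongrightarrow> z" using Cauchy_convergent convergent_def by blast
  have zS: "z \<in> S" using S(2) v(1) z closed_sequentially by blast
  have "(\<lambda>n. J (v n)) \<longlonglongrightarrow> J z" unfolding J_def by (intro tendsto_intros z f.tendsto)
  moreover have "(\<lambda>n. m + 1 / real (Suc n)) \<longlonglongrightarrow> m + 0"
    by (intro tendsto_intros LIMSEQ_Suc[OF lim_1_over_n])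
  ultimately have "J z \<le> m + 0" using v(2) by (intro LIMSEQ_le) (auto intro: less_imp_le)
  then have min: "J z \<le> J w" if "w \<in> S" for w using m_le[OF that] by simp
  have "f h = inner z h" if h: "h \<in> S" for h
  proof -
    define d where "d = inner z h - f h"
    have exp: "J (z + r *\<^sub>R h) = J z + 2 * r * d + r * r * (norm h)^2" for r
      unfolding J_def d_def
      by (simp add: power2_norm_eq_inner inner_commute f.add f.scaleR algebra_simps)
    have pos: "0 \<le> 2 * r * d + r * r * (norm h)^2" for r
      using min[of "z + r *\<^sub>R h"] exp[of r] zS h S(1) by (simp add: subspace_add subspace_mul)
    have "d = 0"
    proof (rule ccontr)
      assume d: "d \<noteq> 0"
      \<comment> \<open>The test value \<open>- d / q\<close> imitates the minimiser of the
        quadratic in \<open>pos\<close>; the summand 1 keeps \<open>q\<close> positive even for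
        \<open>h = 0\<close>.\<close>
      define q where "q = 1 + (norm h)^2"
      have q: "q > 0" "(norm h)^2 < q" unfolding q_def by (auto simp: add_pos_nonneg)
      have "0 \<le> 2 * (- d / q) * d + (- d / q) * (- d / q) * (norm h)^2" by (rule pos)
      also have "\<dots> \<le> 2 * (- d / q) * d + (- d / q) * (- d / q) * q"
        using q by (intro add_left_mono mult_left_mono) auto
      also have "\<dots> = - (d^2 / q)" using q by (simp add: field_simps power2_eq_square)
      finally show False using q d by (simp add: divide_le_0_iff)
    qed
    then show ?thesis unfolding d_def by simp
  qed
  with zS show ?thesis using that by blast
qed

lemma inner_eqI:
  fixes x y :: "'a::real_inner"
  assumes "\<And>z. inner z x = inner z y"
  shows "x = y"
  using assms vector_eq_ldot[of x y] by simp

text \<open>Riesz representation of \<open>inner (T x) y\<close> as a functional of \<open>x\<close>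
  yields \<open>S y\<close>. Linearity of \<open>S\<close> follows because inner products determine
  a vector, and \<open>S\<close> inherits the bound \<open>K\<close> of \<open>T\<close>.\<close>

lemma real_adjoint_exists:
  fixes T :: "'a::{real_inner,complete_space} \<Rightarrow> 'a"
  assumes T: "bounded_linear T"
  obtains S where "bounded_linear S" "\<And>x y. inner (T x) y = inner x (S y)"
proof -
  interpret T: bounded_linear T by fact
  have "\<exists>z. \<forall>x. inner (T x) y = inner x z" for y
  proof -
    have "bounded_linear (\<lambda>x. inner (T x) y)"
      using bounded_linear_compose[OF bounded_linear_inner_left T] .
    from riesz_on_closed_subspace[OF this subspace_UNIV closed_UNIV]
    show ?thesis by (metis UNIV_I inner_commute)
  qed
  then obtain S where S: "\<And>x y. inner (T x) y = inner x (S y)" by metis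
  obtain K where K: "\<And>x. norm (T x) \<le> norm x * K" using T.bounded by blast
  have "bounded_linear S"
  proof (rule bounded_linear_intro[where K = K])
    fix x y
    have "inner z (S (x + y)) = inner z (S x + S y)" for z
      by (simp add: inner_add_right flip: S)
    then show "S (x + y) = S x + S y" by (rule inner_eqI)
  next
    fix r x
    have "inner z (S (r *\<^sub>R x)) = inner z (r *\<^sub>R S x)" for z
      by (simp flip: S)
    then show "S (r *\<^sub>R x) = r *\<^sub>R S x" by (rule inner_eqI)
  next
    fix x
    have "(norm (S x))^2 = inner (T (S x)) x" by (simp add: S power2_norm_eq_inner)
    also have "\<dots> \<le> norm (T (S x)) * norm x" by (rule norm_cauchy_schwarz)
    also have "\<dots> \<le> norm (S x) * K * norm x" by (intro mult_right_mono K) auto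
    finally have "norm (S x) * norm (S x) \<le> norm (S x) * (norm x * K)"
      by (simp add: power2_eq_square mult_ac)
    moreover have "0 \<le> norm x * K" using K[of x] norm_ge_zero order_trans by blast
    ultimately show "norm (S x) \<le> norm x * K"
      by (cases "norm (S x) = 0") (auto simp: mult_le_cancel_left)
  qed
  with S show ?thesis using that by blast
qed

section \<open>The complex structure and complex-linear adjoints\<close>

lemma imult_0 [simp]: "imult (0::'a::complex_hilbert) = 0"
  using imult_scaleR[of 0 "0::'a"] by simp

lemma norm_imult [simp]: "norm (imult x) = norm (x::'a::complex_hilbert)"
  by (simp add: norm_eq_sqrt_inner inner_imult)

lemma bounded_linear_imult: "bounded_linear (imult :: 'a::complex_hilbert \<Rightarrow> 'a)"
  by (rule bounded_linear_intro[where K = 1]) (auto simp: imult_add imult_scaleR)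

lemma inner_imult_left: "inner (imult x) y = - inner x (imult (y::'a::complex_hilbert))"
  using inner_imult[of x "imult y"] by (simp add: imult_imult)

lemma inner_imult_self [simp]: "inner x (imult x) = 0" "inner (imult x) (x::'a::complex_hilbert) = 0"
  using inner_imult_left[of x x] by (simp_all add: inner_commute)

text \<open>The imaginary part of the complex identity is the real identity at
  \<open>imult y\<close>, because \<open>S\<close> commutes with \<open>imult\<close>.\<close>

lemma cinner_eq_adjoint_iff:
  assumes "is_bop T" "is_bop S"
  shows "(\<forall>x y. cinner (T x) y = cinner x (S y)) \<longleftrightarrow> (\<forall>x y. inner (T x) y = inner x (S y))"
  using assms unfolding is_bop_def cinner_def by (auto simp: complex_eq_iff)

text \<open>\<open>imult\<close> is skew-adjoint, so moving it through \<open>T\<close> costs two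
  signs, which cancel.\<close>

lemma adjoint_is_bop:
  assumes T: "is_bop T" and S: "bounded_linear S" "\<And>x y. inner (T x) y = inner x (S y)"
  shows "is_bop S"
proof -
  have "inner x (S (imult y)) = inner x (imult (S y))" for x y
  proof -
    have "inner x (S (imult y)) = - inner (T (imult x)) y"
      using T by (simp add: S(2)[symmetric] inner_imult_left is_bop_def)
    then show ?thesis by (simp add: S(2) inner_imult_left)
  qed
  then have "S (imult y) = imult (S y)" for y by (rule inner_eqI)
  with S show ?thesis unfolding is_bop_def by blast
qed

text \<open>Resolves the definite description in \<open>adj\<close> from a real adjoint relation
  alone.\<close>

lemma adj_eqI:
  assumes T: "is_bop T" and S: "bounded_linear S" "\<And>x y. inner (T x) y = inner x (S y)"
  shows "adj T = S"
  unfolding adj_def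
proof (rule the_equality)
  show "is_bop S \<and> (\<forall>x y. cinner (T x) y = cinner x (S y))"
    using cinner_eq_adjoint_iff[OF T adjoint_is_bop[OF assms]] adjoint_is_bop[OF assms] S by blast
next
  fix R assume R: "is_bop R \<and> (\<forall>x y. cinner (T x) y = cinner x (R y))"
  then have R': "inner (T x) y = inner x (R y)" for x y
    using cinner_eq_adjoint_iff[OF T, of R] by blast
  show "R = S" by (rule ext, rule inner_eqI) (simp flip: S(2) R')
qed

lemma
  assumes T: "is_bop T"
  shows inner_adj: "inner (T x) y = inner x (adj T y)" and is_bop_adj: "is_bop (adj T)"
proof -
  obtain S where S: "bounded_linear S" "\<And>x y. inner (T x) y = inner x (S y)"
    using real_adjoint_exists T unfolding is_bop_def by metis
  with adj_eqI[OF T S] adjoint_is_bop[OF T S]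
  show "inner (T x) y = inner x (adj T y)" "is_bop (adj T)" by simp_all
qed

section \<open>Polynomials of a positive operator\<close>

text \<open>Padding with zero coefficients covers \<open>pCons a 0\<close>, whose degree is 0 and
  not \<open>Suc (degree 0)\<close>.\<close>

lemma poly_op_eq_sum:
  assumes "degree p \<le> n"
  shows "poly_op p A v = (\<Sum>i\<le>n. coeff p i *\<^sub>R (A ^^ i) v)"
  unfolding poly_op_def using assms by (intro sum.mono_neutral_left) (auto simp: coeff_eq_0)

lemma poly_op_0 [simp]: "poly_op 0 A v = 0"
  by (simp add: poly_op_def)

text \<open>Horner recursion; with it the algebraic rules below become inductions over
  \<open>pCons\<close>.\<close>

lemma poly_op_pCons [simp]:
  assumes "linear A"
  shows "poly_op (pCons a p) A v = a *\<^sub>R v + A (poly_op p A v)"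
proof -
  interpret linear A by fact
  have "poly_op (pCons a p) A v = (\<Sum>i\<le>Suc (degree p). coeff (pCons a p) i *\<^sub>R (A ^^ i) v)"
    by (rule poly_op_eq_sum) (simp add: degree_pCons_le)
  also have "\<dots> = a *\<^sub>R v + (\<Sum>i\<le>degree p. coeff p i *\<^sub>R A ((A ^^ i) v))"
    by (subst sum.atMost_Suc_shift) simp
  finally show ?thesis by (simp add: poly_op_def sum scaleR)
qed

context
  fixes A :: "'a::complex_hilbert \<Rightarrow>\<^sub>L 'a"
begin

lemma linear_apply: "linear (blinfun_apply A)"
  by (simp add: blinfun.bounded_linear_right bounded_linear.linear)

lemma poly_op_add: "poly_op (p + q) A v = poly_op p A v + poly_op q A v"
  by (induction p q rule: poly_induct2) (simp_all add: linear_apply blinfun.add_right algebra_simps)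

lemma poly_op_smult: "poly_op (smult c p) A v = c *\<^sub>R poly_op p A v"
  by (induction p) (simp_all add: linear_apply blinfun.scaleR_right algebra_simps)

lemma poly_op_diff: "poly_op (p - q) A v = poly_op p A v - poly_op q A v"
  using poly_op_add[of "p - q" q v] by simp

lemma poly_op_mult: "poly_op (p * q) A v = poly_op p A (poly_op q A v)"
  by (induction p) (simp_all add: linear_apply poly_op_add poly_op_smult)

lemma poly_op_commute: "poly_op p A (A v) = A (poly_op p A v)"
  by (induction p) (simp_all add: linear_apply blinfun.add_right blinfun.scaleR_right blinfun.zero_right)

lemma bounded_linear_poly_op: "bounded_linear (poly_op p A)"
proof (induction p)
  case 0
  have "poly_op 0 A = (\<lambda>v. 0)" by auto
  then show ?case by simp
next
  case (pCons a p)
  have "poly_op (pCons a p) A = (\<lambda>v. a *\<^sub>R v + A (poly_op p A v))" by (auto simp: linear_apply)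
  then show ?case
    by (auto intro!: bounded_linear_add bounded_linear_scaleR_right blinfun.bounded_linear_right
        bounded_linear_compose[OF _ pCons.IH])
qed

text \<open>Lifts \<open>poly_op\<close> to the Banach space of bounded operators, where norms and
  limits can be taken.\<close>

definition poly_bl :: "real poly \<Rightarrow> 'a \<Rightarrow>\<^sub>L 'a" where
  "poly_bl p = Blinfun (poly_op p A)"

lemma poly_bl_apply [simp]: "blinfun_apply (poly_bl p) v = poly_op p A v"
  by (simp add: poly_bl_def bounded_linear_Blinfun_apply bounded_linear_poly_op)

lemma poly_bl_diff: "poly_bl (p - q) = poly_bl p - poly_bl q"
  by (rule blinfun_eqI) (simp add: poly_op_diff blinfun.diff_left)

lemma poly_bl_smult: "poly_bl (smult c p) = c *\<^sub>R poly_bl p"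
  by (rule blinfun_eqI) (simp add: poly_op_smult blinfun.scaleR_left)

lemma poly_bl_mult: "poly_bl (p * q) = poly_bl p o\<^sub>L poly_bl q"
  by (rule blinfun_eqI) (simp add: poly_op_mult)

end

text \<open>Phrased with the real inner product; for operators commuting with \<open>imult\<close>
  this is the usual positivity on a complex Hilbert space.\<close>

definition positive_op :: "('a::complex_hilbert \<Rightarrow>\<^sub>L 'a) \<Rightarrow> bool" where
  "positive_op A \<longleftrightarrow> (\<forall>u v. inner (A u) v = inner u (A v)) \<and> (\<forall>v. 0 \<le> inner (A v) v)"

lemma poly_op_selfadjoint:
  fixes A :: "'a::complex_hilbert \<Rightarrow>\<^sub>L 'a"
  assumes "\<And>u v. inner (A u) v = inner u (A v)"
  shows "inner (poly_op p A u) v = inner u (poly_op p A v)"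
  by (induction p arbitrary: v) (simp_all add: linear_apply inner_add_left inner_add_right assms poly_op_commute)

text \<open>A root outside \<open>[0, norm A]\<close>, real or not, belongs to a factor that is bounded below on
  account of its numerical range.\<close>
lemma poly_op_bounded_below:
  fixes A :: "'a::complex_hilbert \<Rightarrow>\<^sub>L 'a"
  assumes A: "positive_op A" and q: "\<forall>y\<in>{0..norm A}. poly q y \<noteq> 0"
  shows "\<exists>c>0. \<forall>v. c * norm v \<le> norm (poly_op q A v)"
  using q
proof (induction "degree q" arbitrary: q rule: less_induct)
  case (less q)
  have sa: "inner (A u) v = inner u (A v)" and pos: "0 \<le> inner (A v) v" for u v
    using A unfolding positive_op_def by auto
  \<comment> \<open>By Cauchy-Schwarz, a quadratic form bounded away from zero makes the operator
    bounded below.\<close>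
  have CS: "c * norm v \<le> norm w" if "c * (norm v)^2 \<le> \<bar>inner w v\<bar>" for c v and w :: 'a
  proof (cases "v = 0")
    case False
    have "(c * norm v) * norm v \<le> norm w * norm v"
      using that Cauchy_Schwarz_ineq2[of w v] by (simp add: power2_eq_square mult_ac)
    then show ?thesis using False by simp
  qed simp
  \<comment> \<open>Once a factor \<open>d\<close> is bounded below, induction handles the cofactor,
    and the lower bounds multiply.\<close>
  have step: ?case if q: "q = d * q'" "degree q' < degree q" and c: "0 < c"
    "\<And>v. c * norm v \<le> norm (poly_op d A v)" for d q' c
  proof -
    have "\<forall>y\<in>{0..norm A}. poly q' y \<noteq> 0" using less.prems q(1) by auto
    with less.hyps[OF q(2)] obtain c' where c': "c' > 0" "\<And>v. c' * norm v \<le> norm (poly_op q' A v)" by blast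
    have "c * c' * norm v \<le> norm (poly_op q A v)" for v
    proof -
      have "c * c' * norm v \<le> c * norm (poly_op q' A v)" using c'(2)[of v] c(1) by (simp add: mult.assoc)
      also have "\<dots> \<le> norm (poly_op q A v)" unfolding q(1) poly_op_mult by (rule c(2))
      finally show ?thesis .
    qed
    then show ?thesis using c(1) c'(1) by (intro exI[of _ "c * c'"]) auto
  qed
  have q0: "q \<noteq> 0" using less.prems[THEN bspec, of 0] by auto
  show ?case
  proof (cases "degree q = 0")
    case True
    then obtain a where a: "q = [:a:]" by (rule degree_eq_zeroE)
    then have "norm (poly_op q A v) = \<bar>a\<bar> * norm v" for v by (simp add: linear_apply blinfun.zero_right)
    moreover have "\<bar>a\<bar> > 0" using a q0 by auto
    ultimately show ?thesis by (intro exI[of _ "\<bar>a\<bar>"]) auto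
  next
    case False
    define Q where "Q = map_poly complex_of_real q"
    have "degree Q \<noteq> 0" using False unfolding Q_def by (simp add: degree_map_poly)
    then have "\<not> constant (poly Q)" by (simp add: constant_degree)
    then obtain z where z: "poly Q z = 0" using fundamental_theorem_of_algebra by blast
    define a b where "a = Re z" and "b = Im z"
    show ?thesis
    proof (cases "b = 0")
      case True
      then have za: "z = complex_of_real a" unfolding a_def b_def by (simp add: complex_eq_iff)
      have "poly (map_poly complex_of_real p) (complex_of_real a) = complex_of_real (poly p a)" for p
        by (induction p) (simp_all add: map_poly_pCons)
      then have qa: "poly q a = 0" using z unfolding Q_def za by simp
      then obtain q' where q': "q = [:- a, 1:] * q'" by (auto simp: poly_eq_0_iff_dvd dvd_def)
      have dg: "degree q' < degree q" using q' q0 by (subst q', subst degree_mult_eq) auto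
      have "a < 0 \<or> a > norm A" using qa less.prems by force
      \<comment> \<open>The quadratic form of \<open>A - a\<close> keeps one sign on either side of
        the interval, at distance at least \<open>- a\<close> or \<open>a - norm A\<close> from zero
        on unit vectors.\<close>
      then obtain c where "c > 0" "\<And>v. c * (norm v)^2 \<le> \<bar>inner (poly_op [:- a, 1:] A v) v\<bar>"
      proof
        assume "a < 0"
        moreover have "(- a) * (norm v)^2 \<le> \<bar>inner (poly_op [:- a, 1:] A v) v\<bar>" for v
          using pos[of v] by (simp add: linear_apply blinfun.zero_right inner_diff_left power2_norm_eq_inner)
        ultimately show ?thesis using that[of "- a"] by simp
      next
        assume "a > norm A"
        moreover have "(a - norm A) * (norm v)^2 \<le> \<bar>inner (poly_op [:- a, 1:] A v) v\<bar>" for v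
        proof -
          have "inner (A v) v \<le> norm (A v) * norm v" by (rule norm_cauchy_schwarz)
          also have "\<dots> \<le> norm A * norm v * norm v" by (intro mult_right_mono norm_blinfun) auto
          also have "\<dots> = norm A * inner v v" by (simp add: power2_norm_eq_inner[symmetric] power2_eq_square)
          finally show ?thesis
            by (simp add: linear_apply blinfun.zero_right inner_diff_left power2_norm_eq_inner algebra_simps)
        qed
        ultimately show ?thesis using that[of "a - norm A"] by simp
      qed
      then show ?thesis using step[OF q' dg] CS by blast
    next
      case bz: False
      \<comment> \<open>The real quadratic \<open>(y - a)^2 + b^2\<close>, whose roots are
        \<open>z\<close> and its conjugate.\<close>
      define d where "d = [:a^2 + b^2, - 2 * a, 1:]"
      define Z where "Z p = poly (map_poly complex_of_real p) z" for p
      have Zmult: "Z (p * r) = Z p * Z r" and Zadd: "Z (p + r) = Z p + Z r" for p r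
      proof -
        have "map_poly complex_of_real (p * r) = map_poly complex_of_real p * map_poly complex_of_real r"
          "map_poly complex_of_real (p + r) = map_poly complex_of_real p + map_poly complex_of_real r"
          by (simp_all add: poly_eq_iff coeff_map_poly coeff_mult)
        then show "Z (p * r) = Z p * Z r" "Z (p + r) = Z p + Z r" unfolding Z_def by simp_all
      qed
      have Zd: "Z d = 0"
        unfolding Z_def d_def a_def b_def
        by (simp add: map_poly_pCons complex_eq_iff power2_eq_square algebra_simps)
      \<comment> \<open>The remainder is real of degree at most 1 and vanishes at the non-real
        \<open>z\<close>, so it is zero and \<open>d\<close> divides \<open>q\<close>.\<close>
      define r where "r = q mod d"
      have "Z q = 0" using z unfolding Z_def Q_def .
      moreover have "q = d * (q div d) + r" by (simp add: r_def)
      ultimately have Zr: "Z r = 0" using Zmult Zadd Zd by (metis add_0 mult_zero_left)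
      have "degree r < 2 \<or> r = 0" using degree_mod_less[of d q] unfolding r_def d_def by auto
      then have "degree r \<le> 1" by auto
      define e f where "e = coeff r 1" and "f = coeff r 0"
      have r: "r = [:f, e:]"
        using \<open>degree r \<le> 1\<close> unfolding e_def f_def
        by (auto simp: poly_eq_iff coeff_pCons coeff_eq_0 split: nat.split)
      have "e = 0" "f = 0" using Zr bz unfolding r Z_def b_def
        by (auto simp: map_poly_pCons complex_eq_iff)
      then have q': "q = d * (q div d)" using \<open>q = d * (q div d) + r\<close> r by simp
      have "degree d = 2" unfolding d_def by simp
      moreover have "d \<noteq> 0" "q div d \<noteq> 0" using q' q0 by (auto simp: d_def)
      ultimately have dg: "degree (q div d) < degree q" by (subst (2) q', subst degree_mult_eq) auto
      have "b^2 * (norm v)^2 \<le> \<bar>inner (poly_op d A v) v\<bar>" for v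
      proof -
        \<comment> \<open>Completing the square with the symmetric operator \<open>A - a\<close>;
          the term with \<open>b^2\<close> is the lower bound.\<close>
        have "inner (poly_op d A v) v = inner (A v - a *\<^sub>R v) (A v - a *\<^sub>R v) + b^2 * inner v v"
          unfolding d_def
          by (simp add: linear_apply blinfun.zero_right blinfun.add_right blinfun.scaleR_right
              inner_add_left inner_diff_left inner_diff_right sa algebra_simps inner_commute
              power2_eq_square blinfun.diff_right)
        then show ?thesis by (simp add: power2_norm_eq_inner)
      qed
      then show ?thesis using step[OF q' dg, of "b^2"] CS bz by auto
    qed
  qed
qed

text \<open>With \<open>m = norm (q A)\<close>, the operator \<open>m\<^sup>2 - (q A)\<^sup>2\<close> is not bounded below, so
  \<open>m\<^sup>2 - q\<^sup>2\<close> has a root in \<open>[0, norm A]\<close>.\<close>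
lemma norm_poly_bl_le:
  fixes A :: "'a::complex_hilbert \<Rightarrow>\<^sub>L 'a"
  assumes A: "positive_op A" and q: "\<And>y. y \<in> {0..norm A} \<Longrightarrow> \<bar>poly q y\<bar> \<le> c"
  shows "norm (poly_bl A q) \<le> c"
proof (rule ccontr)
  define m where "m = norm (poly_bl A q)"
  let ?C = "poly_op q A"
  assume "\<not> ?thesis"
  then have m: "m > c" unfolding m_def by simp
  have c: "c \<ge> 0" using q[of 0] by (simp add: order_trans[OF abs_ge_zero])
  have m0: "m > 0" using m c by simp
  have "\<forall>y\<in>{0..norm A}. poly ([:m^2:] - q * q) y \<noteq> 0"
  proof
    fix y assume "y \<in> {0..norm A}"
    then have "\<bar>poly q y\<bar> < \<bar>m\<bar>" using q[of y] m by simp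
    then have "(poly q y)^2 < m^2" by (rule power2_strict_mono)
    then show "poly ([:m^2:] - q * q) y \<noteq> 0" by (simp add: power2_eq_square)
  qed
  from poly_op_bounded_below[OF A this] obtain k where
    k: "k > 0" "\<And>v. k * norm v \<le> norm (poly_op ([:m^2:] - q * q) A v)" by blast
  have sa: "inner (?C u) v = inner u (?C v)" for u v
    using A poly_op_selfadjoint unfolding positive_op_def by blast
  have Cm: "norm (?C v) \<le> m * norm v" for v
    using norm_blinfun[of "poly_bl A q" v] by (simp add: m_def)
  \<comment> \<open>Expanding the square of the lower bound and using \<open>Cm\<close> once more
    improves the constant \<open>m^2\<close> by \<open>(k/m)^2\<close>, contradicting the choice of
    \<open>m\<close> as the norm.\<close>
  have main: "(norm (?C v))^2 \<le> (m^2 - (k/m)^2) * (norm v)^2" for v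
  proof -
    have "(k * norm v)^2 \<le> (norm (poly_op ([:m^2:] - q * q) A v))^2"
      using k by (intro power_mono) auto
    also have "\<dots> = (norm (m^2 *\<^sub>R v - ?C (?C v)))^2"
      by (simp add: poly_op_diff poly_op_mult linear_apply blinfun.zero_right)
    also have "\<dots> = m^2 * m^2 * (norm v)^2 - 2 * m^2 * (norm (?C v))^2 + (norm (?C (?C v)))^2"
      unfolding power2_norm_eq_inner by (simp add: inner_diff_left inner_diff_right sa inner_commute)
    also have "(norm (?C (?C v)))^2 \<le> (m * norm (?C v))^2" by (intro power_mono Cm) auto
    finally have "m^2 * (norm (?C v))^2 \<le> m^2 * m^2 * (norm v)^2 - (k * norm v)^2"
      by (simp add: power_mult_distrib)
    also have "\<dots> = m^2 * ((m^2 - (k/m)^2) * (norm v)^2)"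
      using m0 by (simp add: power_mult_distrib power_divide field_simps)
    finally show ?thesis using m0 by simp
  qed
  \<comment> \<open>The maximum with 0 keeps \<open>s\<close> nonnegative, since the sign of
    \<open>m^2 - (k/m)^2\<close> is not known.\<close>
  define s where "s = sqrt (max 0 (m^2 - (k/m)^2))"
  have "norm (poly_bl A q) \<le> s"
  proof (rule norm_blinfun_bound)
    fix v
    have "(norm (?C v))^2 \<le> max 0 (m^2 - (k/m)^2) * (norm v)^2"
      by (rule order_trans[OF main]) (intro mult_right_mono, auto)
    then have "sqrt ((norm (?C v))^2) \<le> sqrt (max 0 (m^2 - (k/m)^2) * (norm v)^2)"
      by (rule real_sqrt_le_mono)
    then show "norm (poly_bl A q v) \<le> s * norm v" by (simp add: s_def real_sqrt_mult)
  qed (simp add: s_def)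
  moreover have "s < m"
    using m0 k(1) unfolding s_def by (intro real_less_lsqrt) (auto simp: max_def)
  ultimately show False unfolding m_def by simp
qed

section \<open>Continuous functional calculus of a positive operator\<close>

text \<open>A relation rather than a function: some polynomials converging uniformly to
  \<open>f\<close> have operator values converging to \<open>B\<close>. Existence and uniqueness are
  shown afterwards for positive \<open>A\<close>.\<close>

definition fcalc :: "('a::complex_hilbert \<Rightarrow>\<^sub>L 'a) \<Rightarrow> (real \<Rightarrow> real) \<Rightarrow> ('a \<Rightarrow>\<^sub>L 'a) \<Rightarrow> bool" where
  "fcalc A f B \<longleftrightarrow> (\<exists>p. uniform_limit {0..norm A} (\<lambda>n. poly (p n)) f sequentially \<and>
     (\<lambda>n. poly_bl A (p n)) \<longlonglongrightarrow> B)"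

lemma fcalc_poly: "fcalc A (poly p) (poly_bl A p)"
  unfolding fcalc_def by (intro exI[of _ "\<lambda>_. p"]) (auto intro: uniform_limit_const)

lemma fcalc_cong:
  assumes "fcalc A f B" "\<And>y. y \<in> {0..norm A} \<Longrightarrow> f y = g y"
  shows "fcalc A g B"
proof -
  have "uniform_limit {0..norm A} (\<lambda>n. poly (p n)) f sequentially \<longleftrightarrow>
        uniform_limit {0..norm A} (\<lambda>n. poly (p n)) g sequentially" for p
    using assms(2) by (intro uniform_limit_cong') auto
  then show ?thesis using assms(1) unfolding fcalc_def by auto
qed

lemma fcalc_one: "fcalc A (\<lambda>_. 1) id_blinfun"
proof -
  have "poly_bl A [:1:] = id_blinfun"
    by (rule blinfun_eqI) (simp add: linear_apply blinfun.zero_right)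
  then show ?thesis using fcalc_cong[OF fcalc_poly[of A "[:1:]"]] by simp
qed

lemma fcalc_id: "fcalc A (\<lambda>y. y) A"
proof -
  have "poly_bl A [:0, 1:] = A"
    by (rule blinfun_eqI) (simp add: linear_apply blinfun.zero_right)
  then show ?thesis using fcalc_cong[OF fcalc_poly[of A "[:0, 1:]"]] by simp
qed

lemma fcalc_diff:
  assumes "fcalc A f B" "fcalc A g C"
  shows "fcalc A (\<lambda>y. f y - g y) (B - C)"
proof -
  obtain p where p: "uniform_limit {0..norm A} (\<lambda>n. poly (p n)) f sequentially"
    "(\<lambda>n. poly_bl A (p n)) \<longlonglongrightarrow> B" using assms(1) unfolding fcalc_def by blast
  obtain q where q: "uniform_limit {0..norm A} (\<lambda>n. poly (q n)) g sequentially"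
    "(\<lambda>n. poly_bl A (q n)) \<longlonglongrightarrow> C" using assms(2) unfolding fcalc_def by blast
  have "uniform_limit {0..norm A} (\<lambda>n. poly (p n - q n)) (\<lambda>y. f y - g y) sequentially"
    using uniform_limit_minus[OF p(1) q(1)] unfolding uniform_limit_iff by simp
  moreover have "(\<lambda>n. poly_bl A (p n - q n)) \<longlonglongrightarrow> B - C"
    using tendsto_diff[OF p(2) q(2)] by (simp add: poly_bl_diff)
  ultimately show ?thesis unfolding fcalc_def by (intro exI[of _ "\<lambda>n. p n - q n"]) auto
qed

text \<open>Continuity on the compact interval makes \<open>f\<close> and \<open>g\<close> bounded,
  as uniform convergence of the products requires.\<close>

lemma fcalc_mult:
  assumes "fcalc A f B" "fcalc A g C"
    and "continuous_on {0..norm A} f" "continuous_on {0..norm A} g"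
  shows "fcalc A (\<lambda>y. f y * g y) (B o\<^sub>L C)"
proof -
  obtain p where p: "uniform_limit {0..norm A} (\<lambda>n. poly (p n)) f sequentially"
    "(\<lambda>n. poly_bl A (p n)) \<longlonglongrightarrow> B" using assms(1) unfolding fcalc_def by blast
  obtain q where q: "uniform_limit {0..norm A} (\<lambda>n. poly (q n)) g sequentially"
    "(\<lambda>n. poly_bl A (q n)) \<longlonglongrightarrow> C" using assms(2) unfolding fcalc_def by blast
  have "uniform_limit {0..norm A} (\<lambda>n. poly (p n * q n)) (\<lambda>y. f y * g y) sequentially"
    using uniform_lim_mult[OF p(1) q(1)] assms(3,4)
    by (simp add: compact_continuous_image compact_imp_bounded uniform_limit_iff)
  moreover have "(\<lambda>n. poly_bl A (p n * q n)) \<longlonglongrightarrow> (B o\<^sub>L C)"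
    using bounded_bilinear.tendsto[OF bounded_bilinear_blinfun_compose p(2) q(2)]
    by (simp add: poly_bl_mult)
  ultimately show ?thesis unfolding fcalc_def by (intro exI[of _ "\<lambda>n. p n * q n"]) auto
qed

lemma fcalc_scaleR:
  assumes "fcalc A f B"
  shows "fcalc A (\<lambda>y. c * f y) (c *\<^sub>R B)"
proof -
  obtain p where p: "uniform_limit {0..norm A} (\<lambda>n. poly (p n)) f sequentially"
    "(\<lambda>n. poly_bl A (p n)) \<longlonglongrightarrow> B" using assms(1) unfolding fcalc_def by blast
  have "uniform_limit {0..norm A} (\<lambda>n. poly (smult c (p n))) (\<lambda>y. c * f y) sequentially"
    using bounded_linear.uniform_limit[OF bounded_linear_mult_right p(1), of c] unfolding uniform_limit_iff by simp
  moreover have "(\<lambda>n. poly_bl A (smult c (p n))) \<longlonglongrightarrow> c *\<^sub>R B"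
    using tendsto_scaleR[OF tendsto_const p(2)] by (simp add: poly_bl_smult)
  ultimately show ?thesis unfolding fcalc_def by (intro exI[of _ "\<lambda>n. smult c (p n)"]) auto
qed

text \<open>The approximating polynomials are eventually bounded by \<open>c + e\<close> on the
  interval, so \<open>norm_poly_bl_le\<close> applies before the limit.\<close>

lemma fcalc_norm_le:
  assumes A: "positive_op A" and f: "fcalc A f B" and c: "\<And>y. y \<in> {0..norm A} \<Longrightarrow> \<bar>f y\<bar> \<le> c"
  shows "norm B \<le> c"
proof (rule field_le_epsilon)
  fix e :: real assume e: "e > 0"
  obtain p where p: "uniform_limit {0..norm A} (\<lambda>n. poly (p n)) f sequentially"
    "(\<lambda>n. poly_bl A (p n)) \<longlonglongrightarrow> B" using f unfolding fcalc_def by blast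
  have "\<forall>\<^sub>F n in sequentially. norm (poly_bl A (p n)) \<le> c + e"
    using uniform_limitD[OF p(1) e]
  proof eventually_elim
    case (elim n)
    show ?case
    proof (rule norm_poly_bl_le[OF A])
      fix y assume "y \<in> {0..norm A}"
      with elim c[OF this] show "\<bar>poly (p n) y\<bar> \<le> c + e" by (force simp: dist_real_def)
    qed
  qed
  then show "norm B \<le> c + e"
    using tendsto_upperbound[OF tendsto_norm[OF p(2)]] by simp
qed

text \<open>The difference of two values represents the zero function, so its norm is at most
  0.\<close>

lemma fcalc_unique:
  assumes "positive_op A" "fcalc A f B" "fcalc A f C"
  shows "B = C"
  using fcalc_norm_le[OF assms(1) fcalc_diff[OF assms(2,3)], of 0] by simp

lemma real_polynomial_function_is_poly:
  fixes g :: "real \<Rightarrow> real"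
  assumes "real_polynomial_function g"
  obtains p where "g = poly p"
proof -
  obtain a n where "g = (\<lambda>x. \<Sum>i\<le>n. a i * x ^ i)"
    using assms real_polynomial_function_iff_sum by blast
  then have "g = poly (\<Sum>i\<le>n. monom (a i) i)" by (auto simp: poly_sum poly_monom)
  then show ?thesis by (rule that)
qed

text \<open>Weierstrass polynomials are uniformly Cauchy, so by \<open>norm_poly_bl_le\<close> their
  operator values are Cauchy in a complete space.\<close>

lemma fcalc_exists:
  assumes A: "positive_op A" and f: "continuous_on {0..norm A} f"
  obtains B where "fcalc A f B"
proof -
  have "\<exists>p. \<forall>y\<in>{0..norm A}. \<bar>f y - poly p y\<bar> < inverse (real (Suc n))" for n
  proof -
    obtain g where g: "real_polynomial_function g" "\<And>y. y \<in> {0..norm A} \<Longrightarrow> \<bar>f y - g y\<bar> < inverse (real (Suc n))"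
      using Stone_Weierstrass_real_polynomial_function[OF compact_Icc f, of "inverse (real (Suc n))"] by auto
    obtain p where "g = poly p" using real_polynomial_function_is_poly g(1) by blast
    then show ?thesis using g(2) by blast
  qed
  then obtain p where p: "\<And>n y. y \<in> {0..norm A} \<Longrightarrow> \<bar>f y - poly (p n) y\<bar> < inverse (real (Suc n))" by metis
  have u: "uniform_limit {0..norm A} (\<lambda>n. poly (p n)) f sequentially"
  proof (rule uniform_limitI)
    fix e :: real assume "e > 0"
    then have "\<forall>\<^sub>F n in sequentially. inverse (real (Suc n)) < e"
      using LIMSEQ_inverse_real_of_nat by (rule order_tendstoD(2)[rotated])
    then show "\<forall>\<^sub>F n in sequentially. \<forall>y\<in>{0..norm A}. dist (poly (p n) y) (f y) < e"
    proof eventually_elim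
      case (elim n)
      then show ?case using p[of _ n] by (fastforce simp: dist_real_def abs_minus_commute)
    qed
  qed
  have "Cauchy (\<lambda>n. poly_bl A (p n))"
  proof (rule metric_CauchyI)
    fix e :: real assume e: "e > 0"
    have "uniformly_Cauchy_on {0..norm A} (\<lambda>n. poly (p n))"
      using u uniformly_convergent_Cauchy unfolding uniformly_convergent_on_def by blast
    then obtain N where N: "\<And>y m n. y \<in> {0..norm A} \<Longrightarrow> m \<ge> N \<Longrightarrow> n \<ge> N \<Longrightarrow>
        dist (poly (p m) y) (poly (p n) y) < e / 2"
      using e unfolding uniformly_Cauchy_on_def by (meson half_gt_zero)
    have "dist (poly_bl A (p m)) (poly_bl A (p n)) < e" if "m \<ge> N" "n \<ge> N" for m n
    proof -
      have "norm (poly_bl A (p m - p n)) \<le> e / 2"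
        using N[OF _ that] by (intro norm_poly_bl_le[OF A]) (auto simp: dist_real_def less_imp_le)
      then show ?thesis using e by (simp add: dist_norm poly_bl_diff)
    qed
    then show "\<exists>M. \<forall>m\<ge>M. \<forall>n\<ge>M. dist (poly_bl A (p m)) (poly_bl A (p n)) < e" by blast
  qed
  then obtain B where "(\<lambda>n. poly_bl A (p n)) \<longlonglongrightarrow> B"
    using Cauchy_convergent convergent_def by blast
  then show ?thesis using that u unfolding fcalc_def by blast
qed

section \<open>Properties passing from polynomials to the functional calculus\<close>

lemma fcalc_pointwise:
  assumes "(\<lambda>n. poly_bl A (p n)) \<longlonglongrightarrow> B"
  shows "(\<lambda>n. poly_op (p n) A v) \<longlonglongrightarrow> B v"
  using blinfun.tendsto[OF assms tendsto_const[of v]] by simp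

lemma fcalc_selfadjoint:
  assumes A: "positive_op A" and f: "fcalc A f B"
  shows "inner (B u) v = inner u (B v)"
proof -
  obtain p where p: "(\<lambda>n. poly_bl A (p n)) \<longlonglongrightarrow> B" using f unfolding fcalc_def by blast
  have "inner (poly_op (p n) A u) v = inner u (poly_op (p n) A v)" for n
    using A poly_op_selfadjoint unfolding positive_op_def by blast
  moreover have "(\<lambda>n. inner (poly_op (p n) A u) v) \<longlonglongrightarrow> inner (B u) v"
    "(\<lambda>n. inner u (poly_op (p n) A v)) \<longlonglongrightarrow> inner u (B v)"
    by (intro tendsto_intros fcalc_pointwise p)+
  ultimately show ?thesis using LIMSEQ_unique by simp
qed

lemma poly_op_imult:
  assumes "\<And>v. blinfun_apply A (imult v) = imult (A v)"
  shows "poly_op p A (imult v) = imult (poly_op p A v)"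
  by (induction p) (simp_all add: linear_apply imult_add imult_scaleR assms)

lemma fcalc_imult:
  assumes A: "\<And>v. blinfun_apply A (imult v) = imult (A v)" and f: "fcalc A f B"
  shows "B (imult v) = imult (B v)"
proof -
  obtain p where p: "(\<lambda>n. poly_bl A (p n)) \<longlonglongrightarrow> B" using f unfolding fcalc_def by blast
  have "(\<lambda>n. imult (poly_op (p n) A v)) \<longlonglongrightarrow> imult (B v)"
    by (intro bounded_linear.tendsto[OF bounded_linear_imult] fcalc_pointwise p)
  then show ?thesis
    using fcalc_pointwise[OF p, of "imult v"] LIMSEQ_unique by (simp add: poly_op_imult A)
qed

lemma uniform_limit_at_0:
  assumes "uniform_limit {0..norm A} (\<lambda>n. poly (p n)) f sequentially"
  shows "(\<lambda>n. poly (p n) 0) \<longlonglongrightarrow> f 0"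
  using tendsto_uniform_limitI[OF assms, of 0] by simp

text \<open>On the kernel of \<open>A\<close>, a polynomial \<open>q\<close> acts as the scalar
  \<open>poly q 0\<close>.\<close>

lemma fcalc_kernel:
  assumes f: "fcalc A f B" "f 0 = 0" and v: "A v = 0"
  shows "B v = 0"
proof -
  obtain p where p: "uniform_limit {0..norm A} (\<lambda>n. poly (p n)) f sequentially"
    "(\<lambda>n. poly_bl A (p n)) \<longlonglongrightarrow> B" using f unfolding fcalc_def by blast
  have "poly_op q A v = poly q 0 *\<^sub>R v" for q
    by (induction q) (simp_all add: linear_apply v blinfun.scaleR_right)
  moreover have "(\<lambda>n. poly (p n) 0 *\<^sub>R v) \<longlonglongrightarrow> f 0 *\<^sub>R v"
    by (intro tendsto_intros uniform_limit_at_0[OF p(1)])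
  ultimately show ?thesis using fcalc_pointwise[OF p(2), of v] LIMSEQ_unique f(2) by fastforce
qed

text \<open>The case split is needed because \<open>0 powr 0 = 0\<close>, whereas \<open>A\<^sup>0 = I\<close>.\<close>
definition pw :: "real \<Rightarrow> real \<Rightarrow> real" where
  "pw s y = (if s = 0 then 1 else y powr s)"

lemma continuous_on_pw: "0 \<le> s \<Longrightarrow> continuous_on {0..c} (pw s)"
  unfolding pw_def by (cases "s = 0") (auto intro!: continuous_on_powr' continuous_on_id continuous_on_const)

lemma pw_add: "\<lbrakk>0 \<le> s; 0 \<le> r; 0 \<le> y\<rbrakk> \<Longrightarrow> pw s y * pw r y = pw (s + r) y"
  unfolding pw_def by (auto simp: powr_add)

lemma pw_1: "0 \<le> y \<Longrightarrow> pw 1 y = y"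
  unfolding pw_def by simp

text \<open>Bridge to the given definition of powers: its epsilon clause is uniform convergence, its
  \<open>onorm\<close> clause is convergence in operator norm, and uniqueness resolves the
  description.\<close>

lemma op_pow_eqI:
  assumes A: "positive_op A" and f: "fcalc A (pw s) B"
  shows "op_pow A s = blinfun_apply B"
proof (cases "s = 0")
  case True
  then have "B = id_blinfun" using fcalc_unique[OF A f, of id_blinfun] fcalc_one[of A] by (simp add: pw_def[abs_def])
  then show ?thesis using True by (auto simp: op_pow_def)
next
  case False
  have eq: "bounded_linear C \<and> (\<exists>p :: nat \<Rightarrow> real poly.
           (\<forall>e>0. \<exists>N. \<forall>n\<ge>N. \<forall>y\<in>{0..onorm (blinfun_apply A)}. \<bar>poly (p n) y - y powr s\<bar> < e) \<and>
           ((\<lambda>n. onorm (\<lambda>v. poly_op (p n) A v - C v)) \<longlonglongrightarrow> 0)) \<longleftrightarrow>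
        (\<exists>D. C = blinfun_apply D \<and> fcalc A (pw s) D)" for C
  proof -
    have norm_eq: "onorm (\<lambda>v. poly_op q A v - blinfun_apply D v) = norm (poly_bl A q - D)"
      for q and D :: "'a \<Rightarrow>\<^sub>L 'a"
      by (simp add: norm_blinfun.rep_eq minus_blinfun.rep_eq)
    have lim: "((\<lambda>n. onorm (\<lambda>v. poly_op (p n) A v - blinfun_apply D v)) \<longlonglongrightarrow> 0) \<longleftrightarrow>
        (\<lambda>n. poly_bl A (p n)) \<longlonglongrightarrow> D" for p and D :: "'a \<Rightarrow>\<^sub>L 'a"
      unfolding norm_eq tendsto_norm_zero_iff LIM_zero_iff ..
    have "bounded_linear C \<longleftrightarrow> (\<exists>D. C = blinfun_apply D)"
      using bounded_linear_Blinfun_apply blinfun.bounded_linear_right by metis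
    then show ?thesis
      using False lim unfolding fcalc_def uniform_limit_sequentially_iff dist_real_def
      by (auto simp: norm_blinfun.rep_eq pw_def) blast
  qed
  have "(THE C. \<exists>D. C = blinfun_apply D \<and> fcalc A (pw s) D) = blinfun_apply B"
    by (rule the_equality) (use f fcalc_unique[OF A f] in blast)+
  then show ?thesis unfolding op_pow_def eq using False by simp
qed

lemma op_pow_fcalc:
  assumes A: "positive_op A" and s: "0 \<le> s"
  obtains B where "op_pow A s = blinfun_apply B" "fcalc A (pw s) B"
  by (rule fcalc_exists[OF A continuous_on_pw[OF s]]) (use op_pow_eqI[OF A] in blast)

text \<open>Here \<open>V\<close> is the adjoint of \<open>U\<close>. For a polynomial \<open>p\<close> one has
  \<open>p (U B V) = U p(B) V + p(0) (1 - U V)\<close>.\<close>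
lemma fcalc_conjugate:
  fixes B C U V :: "'a::complex_hilbert \<Rightarrow>\<^sub>L 'a"
  assumes B: "positive_op B" and adj: "\<And>x y. inner (U x) y = inner x (V y)"
    and VU: "\<And>v. V (U (B v)) = B v" and n: "norm U \<le> 1" "norm V \<le> 1"
    and f: "fcalc B f C" "f 0 = 0"
  shows "positive_op (U o\<^sub>L B o\<^sub>L V)" "fcalc (U o\<^sub>L B o\<^sub>L V) f (U o\<^sub>L C o\<^sub>L V)"
proof -
  define D where "D = U o\<^sub>L B o\<^sub>L V"
  have D: "D v = U (B (V v))" for v by (simp add: D_def)
  have sa: "inner (B u) v = inner u (B v)" and pos: "0 \<le> inner (B v) v" for u v
    using B unfolding positive_op_def by auto
  have adj': "inner (V x) y = inner x (U y)" for x y by (metis adj inner_commute)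
  show "positive_op (U o\<^sub>L B o\<^sub>L V)"
    unfolding positive_op_def using pos by (simp add: adj adj'[symmetric] sa)
  \<comment> \<open>The adjoint form of \<open>VU\<close>, obtained from the symmetry of
    \<open>B\<close>.\<close>
  have BVU: "B (V (U v)) = B v" for v
    by (rule inner_eqI) (simp add: VU flip: sa adj' adj)
  have id: "poly_op p D v = U (poly_op p B (V v)) + poly p 0 *\<^sub>R (v - U (V v))" for p v
  proof (induction p)
    case (pCons a p)
    have "poly_op (pCons a p) D v =
        a *\<^sub>R v + D (U (poly_op p B (V v)) + poly p 0 *\<^sub>R (v - U (V v)))"
      by (simp only: poly_op_pCons[OF linear_apply] pCons.IH)
    also have "\<dots> = U (poly_op (pCons a p) B (V v)) + poly (pCons a p) 0 *\<^sub>R (v - U (V v))"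
      by (simp add: D linear_apply blinfun.add_right blinfun.diff_right blinfun.scaleR_right BVU algebra_simps)
    finally show ?case .
  qed (simp add: blinfun.zero_right)
  obtain p where p: "uniform_limit {0..norm B} (\<lambda>n. poly (p n)) f sequentially"
    "(\<lambda>n. poly_bl B (p n)) \<longlonglongrightarrow> C" using f unfolding fcalc_def by blast
  \<comment> \<open>The contraction bounds place \<open>{0..norm D}\<close> inside
    \<open>{0..norm B}\<close>, where the polynomials converge.\<close>
  have "norm D \<le> norm U * norm B * norm V"
    unfolding D_def by (intro order_trans[OF norm_blinfun_compose] mult_right_mono norm_blinfun_compose) auto
  also have "\<dots> \<le> 1 * norm B * 1" using n by (intro mult_mono) auto
  finally have "{0..norm D} \<subseteq> {0..norm B}" by auto
  then have u: "uniform_limit {0..norm D} (\<lambda>n. poly (p n)) f sequentially"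
    using p(1) uniform_limit_on_subset by blast
  have "poly_bl D (p n) = (U o\<^sub>L poly_bl B (p n) o\<^sub>L V) + poly (p n) 0 *\<^sub>R (id_blinfun - (U o\<^sub>L V))" for n
    by (rule blinfun_eqI) (simp add: id blinfun.add_left blinfun.diff_left blinfun.scaleR_left)
  \<comment> \<open>The correction term disappears in the limit because \<open>poly (p n) 0\<close>
    tends to \<open>f 0 = 0\<close>.\<close>
  moreover have "(\<lambda>n. (U o\<^sub>L poly_bl B (p n) o\<^sub>L V) + poly (p n) 0 *\<^sub>R (id_blinfun - (U o\<^sub>L V)))
      \<longlonglongrightarrow> (U o\<^sub>L C o\<^sub>L V) + f 0 *\<^sub>R (id_blinfun - (U o\<^sub>L V))"
    by (intro tendsto_intros p(2) uniform_limit_at_0[OF p(1)]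
        bounded_bilinear.tendsto[OF bounded_bilinear_blinfun_compose])
  ultimately show "fcalc (U o\<^sub>L B o\<^sub>L V) f (U o\<^sub>L C o\<^sub>L V)"
    using u f(2) unfolding fcalc_def D_def[symmetric] by (intro exI[of _ p]) simp
qed

section \<open>Polar decomposition\<close>

text \<open>Collects what is needed of the absolute value \<open>A\<close>, the square root of
  \<open>B\<close>; the equality of norms comes from \<open>norm (A v) = norm (T v)\<close>.\<close>

lemma abs_op_blinfun:
  fixes T :: "'a::complex_hilbert \<Rightarrow> 'a"
  assumes T: "is_bop T"
  obtains A B where "abs_op T = blinfun_apply A" "positive_op A" "\<And>v. A (imult v) = imult (A v)"
    "blinfun_apply B = adj T \<circ> T" "positive_op B" "B = A o\<^sub>L A" "fcalc B (pw (1/2)) A"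
    "norm A = onorm T"
proof -
  have T': "bounded_linear T" "\<And>v. T (imult v) = imult (T v)"
    and S': "bounded_linear (adj T)" "\<And>v. adj T (imult v) = imult (adj T v)"
    using T is_bop_adj[OF T] unfolding is_bop_def by auto
  define B where "B = Blinfun (adj T \<circ> T)"
  have B: "blinfun_apply B = adj T \<circ> T"
    unfolding B_def using bounded_linear_compose[OF S'(1) T'(1)]
    by (intro bounded_linear_Blinfun_apply) (simp add: o_def)
  have inB: "inner (adj T u) v = inner u (T v)" for u v
    by (metis inner_adj[OF T] inner_commute)
  have posB: "positive_op B"
    unfolding positive_op_def by (simp add: B inB inner_adj[OF T, symmetric])
  obtain A where A: "op_pow B (1/2) = blinfun_apply A" "fcalc B (pw (1/2)) A"
    using op_pow_fcalc[OF posB, of "1/2"] by auto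
  \<comment> \<open>The fourth root serves to prove \<open>A\<close> positive: with
    \<open>A = Q o\<^sub>L Q\<close>, the form \<open>inner (A v) v\<close> is the square of
    \<open>norm (Q v)\<close>.\<close>
  obtain Q where Q: "fcalc B (pw (1/4)) Q"
    using op_pow_fcalc[OF posB, of "1/4"] by auto
  have fm: "fcalc B (pw (s + r)) (C o\<^sub>L D)" if "fcalc B (pw s) C" "fcalc B (pw r) D" "0 \<le> s" "0 \<le> r" for s r C D
    by (rule fcalc_cong[OF fcalc_mult[OF that(1,2)]]) (auto intro: continuous_on_pw that simp: pw_add that)
  have "fcalc B (pw (1/2)) (Q o\<^sub>L Q)" using fm[OF Q Q] by simp
  then have AQ: "A = Q o\<^sub>L Q" using fcalc_unique[OF posB A(2)] by blast
  have "fcalc B (pw 1) (A o\<^sub>L A)" using fm[OF A(2) A(2)] by simp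
  moreover have "fcalc B (pw 1) B" by (rule fcalc_cong[OF fcalc_id]) (simp add: pw_1)
  ultimately have BA: "B = A o\<^sub>L A" using fcalc_unique[OF posB] by blast
  have posA: "positive_op A"
    unfolding positive_op_def
  proof (intro conjI allI)
    fix v show "0 \<le> inner (A v) v"
      using fcalc_selfadjoint[OF posB Q, of "Q v" v] by (simp add: AQ)
  qed (rule fcalc_selfadjoint[OF posB A(2)])
  have iA: "A (imult v) = imult (A v)" for v
    by (rule fcalc_imult[OF _ A(2)]) (simp add: B T' S')
  have "norm (A v) = norm (T v)" for v
  proof -
    have "inner (A v) (A v) = inner (B v) v"
      using posA unfolding positive_op_def BA by simp
    then show ?thesis by (simp add: B inB norm_eq_sqrt_inner)
  qed
  then have "norm A = onorm T" by (simp add: norm_blinfun.rep_eq onorm_def)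
  moreover have "abs_op T = blinfun_apply A" unfolding abs_op_def A(1)[symmetric] B ..
  ultimately show ?thesis using that[of A B] posA iA B posB BA A(2) by blast
qed

text \<open>Project onto the kernel of \<open>U\<close>: Pythagoras gives the contraction, and
  polarising the isometry on the orthogonal complement gives the second claim.\<close>

lemma
  assumes U: "partial_isometry U"
  shows norm_partial_isometry_le: "norm (U v) \<le> norm v"
    and adj_partial_isometry: "(\<And>y. U y = 0 \<Longrightarrow> inner x y = 0) \<Longrightarrow> adj U (U x) = x"
proof -
  have bop: "is_bop U" using U unfolding partial_isometry_def by simp
  then interpret U: bounded_linear U unfolding is_bop_def by simp
  \<comment> \<open>Real orthogonality to the kernel implies complex orthogonality, as the kernel is
    invariant under \<open>imult\<close>.\<close>
  have iso: "norm (U x) = norm x" if "\<And>y. U y = 0 \<Longrightarrow> inner x y = 0" for x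
  proof -
    have "U y = 0 \<Longrightarrow> cinner x y = 0" for y
      using that[of y] that[of "imult y"] bop by (simp add: cinner_def is_bop_def complex_eq_iff)
    then show ?thesis using U unfolding partial_isometry_def by blast
  qed
  define K where "K = {y. U y = 0}"
  have "closed K" unfolding K_def
    by (intro closed_Collect_eq continuous_intros U.continuous_on)
  moreover have "subspace K" unfolding K_def by (auto simp: subspace_def U.add U.scaleR U.zero)
  ultimately have dec: "\<exists>z\<in>K. \<forall>h\<in>K. inner (v - z) h = 0" for v
    using riesz_on_closed_subspace[OF bounded_linear_inner_right, of K v]
    by (metis inner_diff_left right_minus_eq)
  show "norm (U v) \<le> norm v"
  proof -
    obtain z where z: "z \<in> K" "\<And>h. h \<in> K \<Longrightarrow> inner (v - z) h = 0" using dec[of v] by blast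
    have "norm (U v) = norm (U (v - z))" using z(1) by (simp add: K_def U.diff)
    also have "\<dots> = norm (v - z)" using z(2) by (intro iso) (simp add: K_def)
    finally have "(norm (U v))^2 = (norm (v - z))^2" by simp
    also have "\<dots> = (norm v)^2 - (norm z)^2"
      using z(2)[OF z(1)] by (simp add: power2_norm_eq_inner inner_diff_left inner_diff_right inner_commute)
    also have "\<dots> \<le> (norm v)^2" by simp
    finally show ?thesis by simp
  qed
  show "adj U (U x) = x" if x: "\<And>y. U y = 0 \<Longrightarrow> inner x y = 0"
  proof (rule inner_eqI)
    fix v
    obtain z where z: "z \<in> K" "\<And>h. h \<in> K \<Longrightarrow> inner (v - z) h = 0" using dec[of v] by blast
    define w where "w = v - z"
    have w: "U y = 0 \<Longrightarrow> inner w y = 0" for y using z(2) by (simp add: K_def w_def)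
    have Uw: "U w = U v" using z(1) by (simp add: K_def U.diff w_def)
    \<comment> \<open>Polarisation: isometry at \<open>x\<close>, \<open>w\<close> and
      \<open>x + w\<close> forces \<open>inner (U x) (U w) = inner x w\<close>.\<close>
    have "norm (U (x + w)) = norm (x + w)" using x w by (intro iso) (simp add: inner_add_left)
    then have "(norm (U x + U w))^2 = (norm (x + w))^2" by (simp add: U.add)
    moreover have "(norm (U x))^2 = (norm x)^2" "(norm (U w))^2 = (norm w)^2"
      using iso[OF x] iso[OF w] by auto
    ultimately have "inner (U x) (U w) = inner x w"
      unfolding power2_norm_eq_inner by (simp add: inner_add_left inner_add_right inner_commute)
    moreover have "inner x w = inner x v"
      using x[of z] z(1) by (simp add: w_def inner_diff_right K_def)
    ultimately show "inner v (adj U (U x)) = inner v x"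
      using Uw by (simp add: inner_adj[OF bop, symmetric] inner_commute)
  qed
qed

lemma norm_adj_le:
  assumes T: "is_bop T" and c: "\<And>v. norm (T v) \<le> norm v"
  shows "norm (adj T v) \<le> norm v"
proof -
  have "norm (adj T v) * norm (adj T v) = inner (T (adj T v)) v"
    by (simp add: inner_adj[OF T] power2_norm_eq_inner[symmetric] power2_eq_square)
  also have "\<dots> \<le> norm (T (adj T v)) * norm v" by (rule norm_cauchy_schwarz)
  also have "\<dots> \<le> norm (adj T v) * norm v" by (intro mult_right_mono c) auto
  finally show ?thesis by (cases "adj T v = 0") auto
qed

section \<open>The inequality for a unit vector\<close>

text \<open>The witness is the projection coefficient \<open>cinner a b / (norm b)^2\<close>. For
  \<open>b = 0\<close>, division by zero returns 0 and both sides equal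
  \<open>(norm a)^2\<close>.\<close>

lemma norm_diff_projection:
  fixes a b :: "'a::complex_hilbert"
  obtains l where "(norm (a - scaleC l b))^2 = (norm a)^2 - (cmod (cinner a b))^2 / (norm b)^2"
proof
  define p q N where "p = inner a b" and "q = inner a (imult b)" and "N = (norm b)^2"
  have N: "inner b b = N" by (simp add: N_def power2_norm_eq_inner)
  define u v where "u = p / N" and "v = q / N"
  have "(norm (a - scaleC (Complex u v) b))^2 = (norm a)^2 - 2 * u * p - 2 * v * q + (u * u + v * v) * N"
    unfolding power2_norm_eq_inner scaleC_def p_def q_def
    by (simp add: inner_simps inner_imult N inner_commute algebra_simps)
  also have "\<dots> = (norm a)^2 - (p^2 + q^2) / N"
    by (cases "N = 0") (auto simp: u_def v_def field_simps power2_eq_square)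
  finally show "(norm (a - scaleC (Complex u v) b))^2 = (norm a)^2 - (cmod (cinner a b))^2 / (norm b)^2"
    by (simp add: cmod_power2 cinner_def p_def q_def N_def)
qed

text \<open>Complex Cauchy-Schwarz, read off from the nonnegativity of the projection
  residual.\<close>

lemma cmod_cinner_le: "cmod (cinner a b) \<le> norm a * norm b"
proof (cases "b = 0")
  case True
  then show ?thesis by (simp add: cinner_def complex_eq_iff)
next
  case False
  obtain l where "(norm (a - scaleC l b))^2 = (norm a)^2 - (cmod (cinner a b))^2 / (norm b)^2"
    by (rule norm_diff_projection)
  then have "(cmod (cinner a b))^2 / (norm b)^2 \<le> (norm a)^2" by (metis diff_ge_0_iff_ge zero_le_power2)
  then have "(cmod (cinner a b))^2 \<le> (norm a * norm b)^2" using False by (simp add: field_simps power_mult_distrib)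
  then show ?thesis by (rule power2_le_imp_le) simp
qed

text \<open>The hypothesis says that \<open>p = (k a + w) / 2\<close> with \<open>norm w \<le> k norm a\<close>.\<close>
lemma buzano_bound:
  fixes a b p :: "'a::complex_hilbert"
  assumes "norm (2 *\<^sub>R p - k *\<^sub>R a) \<le> k * norm a" "0 \<le> k"
  shows "cmod (cinner p b) \<le> k * ((norm a * norm b + cmod (cinner a b)) / 2)"
proof -
  have "2 * cinner p b = cinner (2 *\<^sub>R p - k *\<^sub>R a) b + of_real k * cinner a b"
    by (simp add: cinner_def complex_eq_iff inner_diff_left)
  then have "2 * cmod (cinner p b) \<le> cmod (cinner (2 *\<^sub>R p - k *\<^sub>R a) b) + k * cmod (cinner a b)"
    using norm_triangle_ineq[of "cinner (2 *\<^sub>R p - k *\<^sub>R a) b" "of_real k * cinner a b"] assms(2)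
    by (metis abs_of_nonneg norm_mult norm_numeral norm_of_real)
  also have "cmod (cinner (2 *\<^sub>R p - k *\<^sub>R a) b) \<le> k * norm a * norm b"
    by (rule order_trans[OF cmod_cinner_le mult_right_mono[OF assms(1)]]) simp
  finally show ?thesis by (simp add: algebra_simps)
qed

text \<open>With \<open>h = g / \<beta>\<close>, the defect \<open>d\<close> is at most
  \<open>(\<alpha> - h) * (\<alpha> + h)\<close>, and \<open>(\<alpha> + h) / (2 * \<alpha>)\<close>
  is at most 1. It is applied with \<open>\<alpha>\<close>, \<open>\<beta>\<close> the norms of the
  two vectors, \<open>g\<close> the modulus of their inner product and \<open>d\<close> the
  infimum.\<close>

lemma defect_bound:
  fixes \<alpha> \<beta> \<gamma> g d :: real
  assumes "0 \<le> \<alpha>" "0 \<le> \<beta>" "\<beta> \<le> \<gamma>" "0 \<le> g" "g \<le> \<alpha> * \<beta>" "d \<le> \<alpha>^2 - g^2 / \<beta>^2"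
  shows "(\<alpha> * \<beta> + g) / 2 \<le> \<alpha> * \<gamma> - \<gamma> / (4 * \<alpha>) * d"
proof (cases "\<alpha> = 0")
  case False
  then have a: "\<alpha> > 0" using assms by simp
  define h where "h = g / \<beta>"
  have h: "0 \<le> h" "h \<le> \<alpha>" "g = \<beta> * h"
    using assms by (cases "\<beta> = 0"; auto simp: h_def divide_le_eq)+
  have "\<gamma> / (4 * \<alpha>) * d \<le> \<gamma> / (4 * \<alpha>) * (\<alpha>^2 - h^2)"
    using assms a by (intro mult_left_mono) (auto simp: h_def power_divide)
  also have "\<dots> = \<gamma> * (\<alpha> - h) / 2 * ((\<alpha> + h) / (2 * \<alpha>))"
    using a by (simp add: field_simps power2_eq_square)
  also have "\<dots> \<le> \<gamma> * (\<alpha> - h) / 2 * 1"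
    using assms a h by (intro mult_left_mono) auto
  finally have "\<gamma> / (4 * \<alpha>) * d \<le> \<alpha> * \<gamma> - \<gamma> * (\<alpha> + h) / 2" by (simp add: field_simps)
  moreover have "\<beta> * (\<alpha> + h) \<le> \<gamma> * (\<alpha> + h)" using assms h a by (intro mult_right_mono) auto
  moreover have "(\<alpha> * \<beta> + g) / 2 = \<beta> * (\<alpha> + h) / 2" using h by (simp add: algebra_simps)
  ultimately show ?thesis by linarith
qed (use assms in simp)

theorem theorem2p10:
  fixes T U :: "'a::complex_hilbert \<Rightarrow> 'a" and x :: "nat \<Rightarrow> 'a" and t L :: real
  assumes "is_bop T" and "T \<noteq> (\<lambda>_. 0)"
    and "partial_isometry U"
    and "\<forall>v. U v = 0 \<longleftrightarrow> abs_op T v = 0"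
    and "\<forall>v. T v = U (abs_op T v)"
    and "\<forall>n. norm (x n) = 1"
    and "(\<lambda>n. cmod (cinner (T (x n)) (x n))) \<longlonglongrightarrow> numrad T"
    and "0 \<le> t" and "t \<le> 1"
    and "(\<lambda>n. norm (op_pow (abs_adj T) (t/2) (x n))
              / (4 * norm (op_pow (abs_op T) (t/2) (x n)))
              * (INF l::complex. (norm (op_pow (abs_op T) (t/2) (x n)
                   - scaleC l (op_pow (abs_op T) (t/2) (adj U (x n))))) ^ 2))
          \<longlonglongrightarrow> L"
  shows "numrad T \<le> onorm T - onorm T powr (1 - t) * L
         \<and> onorm T - onorm T powr (1 - t) * L \<le> onorm T"
proof -
  note T = assms(1) and U = assms(3) and t = assms(8,9)
  obtain A B where A: "abs_op T = blinfun_apply A" "positive_op A" "\<And>v. A (imult v) = imult (A v)"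
    and B: "blinfun_apply B = adj T \<circ> T" "positive_op B" "B = A o\<^sub>L A" "fcalc B (pw (1/2)) A"
    and nA: "norm A = onorm T"
    by (rule abs_op_blinfun[OF T]) blast
  have saA: "inner (A u) v = inner u (A v)" for u v using A(2) unfolding positive_op_def by blast
  define M where "M = onorm T"
  have "bounded_linear T" using T unfolding is_bop_def by simp
  \<comment> \<open>Positivity matters at exponent 0, since \<open>0 powr 0 = 0\<close> while
    \<open>M powr 0\<close> has to be 1.\<close>
  then have M: "M > 0" using assms(2) onorm_pos_lt unfolding M_def by blast
  have nAM: "norm A = M" using nA by (simp add: M_def)
  have bU: "is_bop U" using U unfolding partial_isometry_def by simp
  define Ub V where "Ub = Blinfun U" and "V = Blinfun (adj U)"
  have Ub: "blinfun_apply Ub = U" and V: "blinfun_apply V = adj U"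
    unfolding Ub_def V_def using bU is_bop_adj[OF bU]
    by (auto simp: is_bop_def bounded_linear_Blinfun_apply)
  have nU: "norm (U v) \<le> norm v" for v by (rule norm_partial_isometry_le[OF U])
  have nV: "norm (adj U v) \<le> norm v" for v by (rule norm_adj_le[OF bU nU])
  have nUb: "norm Ub \<le> 1" "norm V \<le> 1"
    by (auto intro!: norm_blinfun_bound simp: Ub V nU nV)
  have adjU: "inner (Ub u) v = inner u (V v)" for u v by (simp add: Ub V inner_adj[OF bU])
  \<comment> \<open>The range of \<open>C\<close> is orthogonal to the common kernel of
    \<open>A\<close> and \<open>U\<close>, hence lies in the initial space of
    \<open>U\<close>.\<close>
  have VU: "V (Ub (C v)) = C v" if "fcalc A f C" "f 0 = 0" for f C v
    unfolding Ub V
  proof (rule adj_partial_isometry[OF U])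
    fix y assume "U y = 0"
    then have "A y = 0" using assms(4) A(1) by simp
    then have "C y = 0" by (rule fcalc_kernel[OF that])
    then show "inner (C v) y = 0" by (simp add: fcalc_selfadjoint[OF A(2) that(1)])
  qed
  have VUA: "V (Ub (A v)) = A v" for v using VU[OF fcalc_id] by simp
  have TUA: "T v = Ub (A v)" for v using assms(5) A(1) by (simp add: Ub)
  have adjT: "adj T = (\<lambda>v. A (V v))"
    by (rule adj_eqI[OF T]) (auto simp: TUA adjU saA intro: bounded_linear_compose blinfun.bounded_linear_right)
  have VUB: "V (Ub (B v)) = B v" for v by (simp add: B(3) VUA)
  \<comment> \<open>\<open>T \<circ> adj T\<close> is \<open>B\<close> conjugated by
    \<open>U\<close>, and conjugation commutes with the square root.\<close>
  have abs_adj: "abs_adj T = blinfun_apply (Ub o\<^sub>L A o\<^sub>L V)"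
  proof -
    have "T \<circ> adj T = blinfun_apply (Ub o\<^sub>L B o\<^sub>L V)" by (auto simp: TUA adjT B(3))
    moreover have "pw (1/2) 0 = 0" by (simp add: pw_def)
    ultimately show ?thesis unfolding abs_adj_def
      using op_pow_eqI fcalc_conjugate[OF B(2) adjU VUB nUb B(4)] by simp
  qed
  define s where "s = t / 2"
  have s: "0 \<le> s" "0 \<le> 1 - t" "s + (1 - t + s) = 1" using t by (auto simp: s_def)
  obtain S where S: "op_pow A s = blinfun_apply S" "fcalc A (pw s) S" by (rule op_pow_fcalc[OF A(2) s(1)])
  obtain P where P: "fcalc A (pw (1 - t)) P" using op_pow_fcalc[OF A(2) s(2)] by blast
  have saS: "inner (S u) v = inner u (S v)" for u v by (rule fcalc_selfadjoint[OF A(2) S(2)])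
  have iS: "S (imult v) = imult (S v)" for v by (rule fcalc_imult[OF A(3) S(2)])
  have ASPS: "A v = S (P (S v))" for v
  proof -
    have "fcalc A (\<lambda>y. pw s y * (pw (1 - t) y * pw s y)) (S o\<^sub>L (P o\<^sub>L S))"
      by (intro fcalc_mult S P continuous_on_mult continuous_on_pw s)
    then have "fcalc A (\<lambda>y. y) (S o\<^sub>L (P o\<^sub>L S))"
      by (rule fcalc_cong) (use s t in \<open>simp add: pw_add pw_1\<close>)
    then have "A = S o\<^sub>L (P o\<^sub>L S)" by (rule fcalc_unique[OF A(2) fcalc_id])
    then show ?thesis by (metis blinfun_apply_blinfun_compose)
  qed
  have pw_bound: "0 \<le> pw r y" "pw r y \<le> M powr r" if "y \<in> {0..norm A}" "0 \<le> r" for r y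
    using that M by (auto simp: pw_def nAM intro!: powr_mono2)
  define k where "k = M powr (1 - t)"
  have nS: "norm S \<le> M powr s"
    using pw_bound s by (intro fcalc_norm_le[OF A(2) S(2)]) auto
  \<comment> \<open>The values of \<open>pw (1 - t)\<close> lie in \<open>{0..k}\<close>, so
    doubling and subtracting \<open>k\<close> lands in \<open>{-k..k}\<close>.\<close>
  have "norm (2 *\<^sub>R P - k *\<^sub>R id_blinfun) \<le> k"
  proof (rule fcalc_norm_le[OF A(2) fcalc_diff[OF fcalc_scaleR[OF P] fcalc_scaleR[OF fcalc_one]]])
    fix y assume "y \<in> {0..norm A}"
    from pw_bound[OF this s(2)] show "\<bar>2 * pw (1 - t) y - k * 1\<bar> \<le> k" by (auto simp: k_def)
  qed
  then have nP: "norm (2 *\<^sub>R P v - k *\<^sub>R v) \<le> k * norm v" for v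
    using norm_blinfun[of "2 *\<^sub>R P - k *\<^sub>R id_blinfun" v]
    by (simp add: blinfun.diff_left blinfun.scaleR_left) (meson mult_right_mono norm_ge_zero order_trans)
  define c where "c v = op_pow (abs_adj T) s v" for v
  have c: "norm (S (V v)) \<le> norm (c v)" "norm (c v) \<le> M powr s" if v: "norm v = 1" for v
  proof -
    have "norm (S (V v)) \<le> M powr s * norm v"
      by (rule order_trans[OF norm_blinfun mult_mono[OF nS]]) (auto simp: V nV)
    then have SV: "norm (S (V v)) \<le> M powr s" using v by simp
    have "norm (S (V v)) \<le> norm (c v) \<and> norm (c v) \<le> M powr s"
    proof (cases "s = 0")
      case True
      then have "c v = v" by (simp add: c_def op_pow_def)
      then show ?thesis using SV v True M by simp
    next
      case False
      then have f0: "pw s 0 = 0" by (simp add: pw_def)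
      have "c v = Ub (S (V v))"
        unfolding c_def abs_adj op_pow_eqI[OF fcalc_conjugate[OF A(2) adjU VUA nUb S(2) f0]] by simp
      \<comment> \<open>\<open>U\<close> preserves this norm: \<open>V\<close> undoes
        \<open>U\<close> on the range of \<open>S\<close>, and both are contractions.\<close>
      moreover have "norm (Ub (S (V v))) = norm (S (V v))"
        using VU[OF S(2) f0, of "V v"] nU[of "S (V v)"] nV[of "U (S (V v))"] by (simp add: Ub V)
      ultimately show ?thesis using SV by simp
    qed
    then show "norm (S (V v)) \<le> norm (c v)" "norm (c v) \<le> M powr s" by auto
  qed
  define F where "F v = norm (c v) / (4 * norm (S v)) *
      (INF l::complex. (norm (S v - scaleC l (S (V v))))^2)" for v
  have bdd: "bdd_below (range (\<lambda>l. (norm (S v - scaleC l (S (V v))))^2))" for v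
    by (rule bdd_belowI2[where m = 0]) simp
  have F0: "0 \<le> F v" for v
    unfolding F_def by (intro mult_nonneg_nonneg divide_nonneg_nonneg cINF_greatest) auto
  have main: "cmod (cinner (T v) v) \<le> M - k * F v" if v: "norm v = 1" for v
  proof -
    let ?a = "S v" and ?b = "S (V v)"
    \<comment> \<open>Write \<open>T = U S P S\<close> and move \<open>U\<close> and the outer
      \<open>S\<close> to the second argument.\<close>
    have "cinner (T v) v = cinner (P ?a) ?b"
      unfolding cinner_def by (simp add: TUA ASPS adjU saS V iS[symmetric] is_bop_adj[OF bU, unfolded is_bop_def])
    then have "cmod (cinner (T v) v) \<le> k * ((norm ?a * norm ?b + cmod (cinner ?a ?b)) / 2)"
      using buzano_bound[OF nP] by (simp add: k_def)
    also have "\<dots> \<le> k * (norm ?a * norm (c v) - F v)"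
    proof (intro mult_left_mono)
      \<comment> \<open>The optimal scalar bounds the infimum above by the projection residual, as
        \<open>defect_bound\<close> requires.\<close>
      obtain l where l: "(norm (?a - scaleC l ?b))^2 = (norm ?a)^2 - (cmod (cinner ?a ?b))^2 / (norm ?b)^2"
        by (rule norm_diff_projection)
      show "(norm ?a * norm ?b + cmod (cinner ?a ?b)) / 2 \<le> norm ?a * norm (c v) - F v"
        unfolding F_def
        by (intro defect_bound cmod_cinner_le c v) (auto simp: l[symmetric] intro!: cINF_lower bdd)
    qed (simp add: k_def)
    also have "\<dots> = k * (norm ?a * norm (c v)) - k * F v" by (simp add: algebra_simps)
    \<comment> \<open>Both norms are at most \<open>M powr s\<close>, and the exponents
      \<open>1 - t\<close>, \<open>s\<close>, \<open>s\<close> add up to 1.\<close>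
    also have "k * (norm ?a * norm (c v)) \<le> k * (M powr s * M powr s)"
      using c(2)[OF v] norm_blinfun[of S v] nS v by (intro mult_left_mono mult_mono) (auto simp: k_def)
    also have "\<dots> = M"
      using M s(3) by (simp add: k_def s_def flip: powr_add)
    finally show ?thesis by simp
  qed
  have lim: "(\<lambda>n. F (x n)) \<longlonglongrightarrow> L"
    using assms(10) unfolding F_def c_def A(1) S(1)[unfolded s_def] V s_def by simp
  \<comment> \<open>This sign is the second inequality of the claim.\<close>
  have "L \<ge> 0" using lim F0 by (intro LIMSEQ_le_const) auto
  moreover have "numrad T \<le> M - k * L"
    using assms(6) main by (intro LIMSEQ_le[OF assms(7), of "\<lambda>n. M - k * F (x n)"] tendsto_intros lim) auto
  ultimately show ?thesis by (simp add: M_def k_def)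
qed

end
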